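(* Let $\alpha=\alpha_0,\alpha_1,\dots,\alpha_N$ be skew-symmetric forms on $\mathbb R^n$ with $\alpha$ a calibration $k$-form, let $\mathrm{G}\subset\mathrm{SO}(n)$ be their common stabilizer with Lie algebra $\mathfrak g$, and assume $\mathrm{G}$ acts transitively on the set $\mathrm{Gr}_\alpha$ of $\alpha$-calibrated $k$-planes. Let $W\in\mathrm{Gr}_\alpha$ and let $\phi=\mathrm{Id}_W\times(-\mathrm{Id}_{W^\perp})\in\mathrm{O}(n)$. Then $\alpha$ is compliant (with respect to $W$) if and only if $\mathrm{Ad}(\phi)(\mathfrak g)=\mathfrak g$; that is, if and only if $\mathrm{Ad}(\phi)\in\mathrm{Aut}(\mathfrak g)$.
   Context: $\mathbb R^n$ has its standard inner product and orientation; vectors and covectors are identified, so $\Lambda^2(\mathbb R^n)=\mathfrak{so}(n)$, with its standard ($\mathrm{Ad}$-invariant) inner product. For $1\le k\le n-1$, $\alpha\in\Lambda^k(\mathbb R^n)$ is a calibration if $\alpha|_W\le\mathrm{vol}_W$ for every oriented $k$-plane $W$, with equality for at least one $W$; an oriented $k$-plane $W$ is $\alpha$-calibrated if $\alpha|_W=\mathrm{vol}_W$, and $\mathrm{Gr}_\alpha$ is the set of these. $\mathrm{G}=\{P\in\mathrm{SO}(n):P^*\alpha_j=\alpha_j,\ 0\le j\le N\}$, where the $\alpha_j$ may have different degrees. For $W\in\mathrm{Gr}_\alpha$, $\mathrm{H}_W=\{P\in\mathrm{G}:P(W)=W\}=\mathrm{G}\cap(\mathrm{SO}(W)\times\mathrm{SO}(W^\perp))$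 has Lie algebra $\mathfrak h=\mathfrak g\cap(\Lambda^2W\oplus\Lambda^2W^\perp)$, and $\mathfrak h^{\perp_{\mathfrak g}}$ is the orthogonal complement of $\mathfrak h$ in $\mathfrak g$. Using $\mathfrak{so}(n)=(\Lambda^2W\oplus\Lambda^2W^\perp)\oplus(W\otimes W^\perp)$, $\alpha$ is called compliant (with respect to $W$) if $\mathfrak h^{\perp_{\mathfrak g}}=\mathfrak g\cap(W\otimes W^\perp)$. $\mathrm{Ad}(\phi)\in\mathrm{Aut}(\mathfrak{so}(n))$ is $\mathrm{Ad}(\phi)(X)=\phi X\phi^{-1}$; "$\mathrm{Ad}(\phi)\in\mathrm{Aut}(\mathfrak g)$" means that it restricts to an automorphism of $\mathfrak g$. *)

theory Defs
  imports "Jordan_Normal_Form.Determinant" "HOL-Analysis.Analysis"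
begin

text \<open>
  Tuples of vectors are lists.  A skew-symmetric \<open>k\<close>-form is a function on tuples that is multilinear
  and skew-symmetric on tuples of length \<open>k\<close>; it is normalised to vanish on tuples of any other
  length, so that equality of \<open>k\<close>-forms is equality of functions.
\<close>

definition skew_form :: "nat \<Rightarrow> ((real^'n) list \<Rightarrow> real) \<Rightarrow> bool" where
  "skew_form k \<alpha> \<longleftrightarrow>
     (\<forall>vs. length vs \<noteq> k \<longrightarrow> \<alpha> vs = 0) \<and>
     (\<forall>vs i. length vs = k \<longrightarrow> i < k \<longrightarrow> linear (\<lambda>x. \<alpha> (vs[i := x]))) \<and>
     (\<forall>vs i j. length vs = k \<longrightarrow> i < k \<longrightarrow> j < k \<longrightarrow> i \<noteq> j \<longrightarrow>
        \<alpha> (vs[i := vs ! j, j := vs ! i]) = - \<alpha> vs)"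

definition pullback :: "real^'n^'n \<Rightarrow> ((real^'n) list \<Rightarrow> real) \<Rightarrow> (real^'n) list \<Rightarrow> real" where
  "pullback P \<alpha> = (\<lambda>vs. \<alpha> (map ((*v) P) vs))"

definition ordered_basis :: "(real^'n) set \<Rightarrow> (real^'n) list \<Rightarrow> bool" where
  "ordered_basis W bs \<longleftrightarrow> distinct bs \<and> independent (set bs) \<and> span (set bs) = W"

text \<open>The determinant of the matrix whose \<open>j\<close>-th column holds the coordinates of \<open>vs ! j\<close> in the
  basis \<open>bs\<close>.  The size of this matrix is a natural number rather than a type, hence the matrices of
  \<^theory>\<open>Jordan_Normal_Form.Determinant\<close>.\<close>

definition coord_det :: "(real^'n) list \<Rightarrow> (real^'n) list \<Rightarrow> real" where
  "coord_det bs vs = Determinant.det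
     (Matrix.mat (length bs) (length bs) (\<lambda>(i, j). representation (set bs) (vs ! j) (bs ! i)))"

text \<open>An orientation of \<open>W\<close> is given as the set of its positively oriented ordered bases.\<close>

definition orientation :: "(real^'n) set \<Rightarrow> (real^'n) list set \<Rightarrow> bool" where
  "orientation W Or \<longleftrightarrow>
     (\<exists>bs. ordered_basis W bs \<and> Or = {cs. ordered_basis W cs \<and> 0 < coord_det bs cs})"

type_synonym 'n oriented_plane = "(real^'n) set \<times> (real^'n) list set"

definition oriented_planes :: "nat \<Rightarrow> 'n::finite oriented_plane set" where
  "oriented_planes k = {(W, Or). subspace W \<and> dim W = k \<and> orientation W Or}"

definition orthonormal :: "(real^'n) list \<Rightarrow> bool" where
  "orthonormal es \<longleftrightarrow>
     (\<forall>i < length es. \<forall>j < length es. es ! i \<bullet> es ! j = (if i = j then 1 else 0))"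

text \<open>The volume form of an oriented plane, to be evaluated on tuples of vectors of that plane; it does
  not depend on the chosen positively oriented orthonormal basis.\<close>

definition vol_form :: "'n::finite oriented_plane \<Rightarrow> (real^'n) list \<Rightarrow> real" where
  "vol_form W = coord_det (SOME es. es \<in> snd W \<and> orthonormal es)"

text \<open>Top-degree forms on an oriented plane are compared on its positively oriented bases.\<close>

definition restr_le_vol :: "((real^'n) list \<Rightarrow> real) \<Rightarrow> 'n::finite oriented_plane \<Rightarrow> bool" where
  "restr_le_vol \<alpha> W \<longleftrightarrow> (\<forall>vs \<in> snd W. \<alpha> vs \<le> vol_form W vs)"

definition calibrated :: "nat \<Rightarrow> ((real^'n) list \<Rightarrow> real) \<Rightarrow> 'n::finite oriented_plane \<Rightarrow> bool" where
  "calibrated k \<alpha> W \<longleftrightarrow> W \<in> oriented_planes k \<and>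
     (\<forall>vs. length vs = k \<longrightarrow> set vs \<subseteq> fst W \<longrightarrow> \<alpha> vs = vol_form W vs)"

definition calibrated_planes :: "nat \<Rightarrow> ((real^'n) list \<Rightarrow> real) \<Rightarrow> 'n::finite oriented_plane set" where
  "calibrated_planes k \<alpha> = {W. calibrated k \<alpha> W}"

definition calibration :: "nat \<Rightarrow> ((real^'n) list \<Rightarrow> real) \<Rightarrow> bool" where
  "calibration k \<alpha> \<longleftrightarrow> 1 \<le> k \<and> k \<le> CARD('n) - 1 \<and> skew_form k \<alpha> \<and>
     (\<forall>W \<in> oriented_planes k. restr_le_vol \<alpha> W) \<and> (\<exists>W. calibrated k \<alpha> W)"

definition common_stabilizer :: "nat \<Rightarrow> (nat \<Rightarrow> (real^'n) list \<Rightarrow> real) \<Rightarrow> (real^'n^'n) set" where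
  "common_stabilizer N \<alpha> = {P. rotation_matrix P \<and> (\<forall>j \<le> N. pullback P (\<alpha> j) = \<alpha> j)}"

definition move_plane :: "real^'n^'n \<Rightarrow> 'n::finite oriented_plane \<Rightarrow> 'n oriented_plane" where
  "move_plane P W = ((*v) P ` fst W, map ((*v) P) ` snd W)"

definition transitive_on_planes :: "(real^'n^'n) set \<Rightarrow> 'n::finite oriented_plane set \<Rightarrow> bool" where
  "transitive_on_planes G S \<longleftrightarrow>
     (\<forall>U \<in> S. \<forall>V \<in> S. \<exists>P \<in> G. move_plane P U = V)"

text \<open>\<open>\<gamma>\<close> is infinitely differentiable on the open set \<open>T\<close>, with \<open>m\<close>-th derivative \<open>D m\<close>.\<close>

definition smooth_curve_on :: "real set \<Rightarrow> (real \<Rightarrow> real^'n^'n) \<Rightarrow> bool" where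
  "smooth_curve_on T \<gamma> \<longleftrightarrow>
     (\<exists>D. D 0 = \<gamma> \<and> (\<forall>m. \<forall>t \<in> T. (D m has_vector_derivative D (Suc m) t) (at t)))"

text \<open>The Lie algebra of a closed matrix group, as the tangent space at the identity.\<close>

definition lie_algebra :: "(real^'n^'n) set \<Rightarrow> (real^'n^'n) set" where
  "lie_algebra G = {X. \<exists>\<gamma>. \<exists>\<epsilon> > 0. smooth_curve_on {-\<epsilon><..<\<epsilon>} \<gamma> \<and>
     (\<forall>t \<in> {-\<epsilon><..<\<epsilon>}. \<gamma> t \<in> G) \<and> \<gamma> 0 = mat 1 \<and> (\<gamma> has_vector_derivative X) (at 0)}"

text \<open>Only the underlying subspace is required to be preserved.  For a group \<open>G\<close> of rotations fixing a
  form that calibrates \<open>W\<close>, preservation of the orientations of \<open>W\<close> and \<open>W\<^sup>\<bottom>\<close> is automatic.\<close>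

definition plane_stabilizer :: "(real^'n^'n) set \<Rightarrow> (real^'n) set \<Rightarrow> (real^'n^'n) set" where
  "plane_stabilizer G W = {P \<in> G. (*v) P ` W = W}"

text \<open>The bivector \<open>u \<and> v\<close> as a skew-symmetric matrix.\<close>

definition wedge :: "real^'n \<Rightarrow> real^'n \<Rightarrow> real^'n^'n" where
  "wedge u v = (\<chi> i j. u $ i * v $ j - v $ i * u $ j)"

text \<open>\<open>W \<otimes> W\<^sup>\<bottom>\<close> as a subspace of the skew-symmetric matrices, with \<open>w \<otimes> x\<close> identified with \<open>w \<and> x\<close>.\<close>

definition mixed_part :: "(real^'n) set \<Rightarrow> (real^'n^'n) set" where
  "mixed_part W = span {wedge w x | w x. w \<in> W \<and> x \<in> W\<^sup>\<bottom>}"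

text \<open>The library inner product on matrices is the trace form \<open>tr (X\<^sup>T Y)\<close>; on skew-symmetric matrices
  it is twice the \<open>Ad\<close>-invariant one for which the \<open>e\<^sub>i \<and> e\<^sub>j\<close> with \<open>i < j\<close> are orthonormal, so the
  orthogonal complements agree.\<close>

definition compliant :: "(real^'n^'n) set \<Rightarrow> (real^'n) set \<Rightarrow> bool" where
  "compliant G W \<longleftrightarrow>
     lie_algebra G \<inter> (lie_algebra (plane_stabilizer G W))\<^sup>\<bottom> = lie_algebra G \<inter> mixed_part W"

definition Ad :: "real^'n^'n \<Rightarrow> real^'n^'n \<Rightarrow> real^'n^'n" where
  "Ad \<phi> X = \<phi> ** X ** matrix_inv \<phi>"

definition bracket :: "real^'n^'n \<Rightarrow> real^'n^'n \<Rightarrow> real^'n^'n" where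
  "bracket X Y = X ** Y - Y ** X"

definition restricts_to_lie_automorphism ::
  "(real^'n^'n \<Rightarrow> real^'n^'n) \<Rightarrow> (real^'n^'n) set \<Rightarrow> bool" where
  "restricts_to_lie_automorphism f \<gg> \<longleftrightarrow> bij_betw f \<gg> \<gg> \<and>
     (\<forall>X \<in> \<gg>. \<forall>Y \<in> \<gg>. f (X + Y) = f X + f Y) \<and>
     (\<forall>c. \<forall>X \<in> \<gg>. f (c *\<^sub>R X) = c *\<^sub>R f X) \<and>
     (\<forall>X \<in> \<gg>. \<forall>Y \<in> \<gg>. f (bracket X Y) = bracket (f X) (f Y))"

end

theory Submission
  imports Defs
begin

text \<open>
  The Lie algebra \<open>\<gg>\<close> of the common stabilizer consists of the skew matrices that annihilate all the
  forms infinitesimally: differentiate a curve in \<open>G\<close> for one inclusion, exponentiate for the other.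
  A rotation preserves \<open>W\<close> iff it commutes with the reflection \<open>\<phi>\<close>, so the Lie algebra \<open>\<hh>\<close> of the
  stabilizer of \<open>W\<close> is the fixed space of \<open>Ad \<phi>\<close> in \<open>\<gg>\<close>, while \<open>W \<otimes> W\<^sup>\<bottom>\<close> is the \<open>(-1)\<close>-eigenspace
  of \<open>Ad \<phi>\<close> on skew matrices.  The involution \<open>Ad \<phi>\<close> is self-adjoint.  If it preserves \<open>\<gg>\<close>, the
  orthogonal complement in \<open>\<gg>\<close> of its fixed space is its \<open>(-1)\<close>-eigenspace there; conversely, if
  that complement is anti-invariant, then \<open>\<gg>\<close> is a sum of two eigenspaces and so is preserved.
\<close>

no_notation vec_index (infixl "$" 100)
no_notation scalar_prod (infix "\<bullet>" 70)

subsection \<open>Derivatives of multilinear forms\<close>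

definition multilinear_form :: "nat \<Rightarrow> ('a::euclidean_space list \<Rightarrow> real) \<Rightarrow> bool" where
  "multilinear_form k F \<longleftrightarrow> (\<forall>vs i. length vs = k \<longrightarrow> i < k \<longrightarrow> linear (\<lambda>x. F (vs[i := x])))"

lemma multilinear_form_linear:
  "multilinear_form k F \<Longrightarrow> length vs = k \<Longrightarrow> i < k \<Longrightarrow> linear (\<lambda>x. F (vs[i := x]))"
  by (simp add: multilinear_form_def)

lemma multilinear_form_Cons:
  assumes "multilinear_form (Suc k) F"
  shows "multilinear_form k (\<lambda>vs. F (x # vs))"
  unfolding multilinear_form_def
proof (intro allI impI)
  fix vs :: "'a list" and i assume "length vs = k" "i < k"
  then show "linear (\<lambda>y. F (x # vs[i := y]))"
    using multilinear_form_linear[OF assms, of "x # vs" "Suc i"] by simp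
qed

text \<open>Expanding the first slot in the orthonormal basis turns a form in \<open>Suc k\<close>
  moving vectors into a finite sum of scalar functions times forms in \<open>k\<close> moving
  vectors. This feeds the induction below.\<close>

lemma multilinear_form_Cons_expand:
  assumes "multilinear_form (Suc k) F" "length vs = k"
  shows "F (x # vs) = (\<Sum>b\<in>Basis. (x \<bullet> b) * F (b # vs))"
proof -
  have lin: "linear (\<lambda>y. F (y # vs))"
    using multilinear_form_linear[OF assms(1), of "0 # vs" 0] assms(2) by simp
  have "F (x # vs) = F ((\<Sum>b\<in>Basis. (x \<bullet> b) *\<^sub>R b) # vs)"
    by (simp add: euclidean_representation)
  also have "\<dots> = (\<Sum>b\<in>Basis. (x \<bullet> b) * F (b # vs))"
    by (simp add: linear_sum[OF lin] linear_scale[OF lin])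
  finally show ?thesis .
qed

text \<open>The product rule, one term per slot. Induction on \<open>k\<close> with \<open>F\<close>
  varying: each \<open>F (b # _)\<close> is multilinear in the remaining slots, so the scalar
  product rule handles the head.\<close>

lemma multilinear_form_has_real_derivative:
  assumes "multilinear_form k F"
    and "\<And>i. i < k \<Longrightarrow> (g i has_vector_derivative g' i) (at t)"
  shows "((\<lambda>s. F (map (\<lambda>i. g i s) [0..<k])) has_real_derivative
          (\<Sum>i<k. F ((map (\<lambda>i. g i t) [0..<k])[i := g' i]))) (at t)"
  using assms
proof (induction k arbitrary: F g g')
  case 0
  then show ?case by simp
next
  case (Suc k)
  let ?vs = "\<lambda>s. map (\<lambda>i. g (Suc i) s) [0..<k]"
  have ml: "multilinear_form k (\<lambda>vs. F (b # vs))" for b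
    using Suc.prems(1) by (rule multilinear_form_Cons)
  have tail: "((\<lambda>s. F (b # ?vs s)) has_real_derivative
      (\<Sum>i<k. F (b # (?vs t)[i := g' (Suc i)]))) (at t)" for b
    using Suc.IH[OF ml, of "\<lambda>i. g (Suc i)" "\<lambda>i. g' (Suc i)"] Suc.prems(2) by simp
  have head: "((\<lambda>s. g 0 s \<bullet> b) has_real_derivative g' 0 \<bullet> b) (at t)" for b
    using bounded_linear.has_vector_derivative[OF bounded_linear_inner_left Suc.prems(2)[of 0]]
    by (simp add: has_real_derivative_iff_has_vector_derivative)
  have "((\<lambda>s. \<Sum>b\<in>Basis. (g 0 s \<bullet> b) * F (b # ?vs s)) has_real_derivative
      (\<Sum>b\<in>Basis. (g' 0 \<bullet> b) * F (b # ?vs t)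
        + (\<Sum>i<k. F (b # (?vs t)[i := g' (Suc i)])) * (g 0 t \<bullet> b))) (at t)"
    by (intro DERIV_sum DERIV_mult head tail)
  moreover have "(\<lambda>s. \<Sum>b\<in>Basis. (g 0 s \<bullet> b) * F (b # ?vs s)) =
      (\<lambda>s. F (map (\<lambda>i. g i s) [0..<Suc k]))"
    by (simp add: multilinear_form_Cons_expand[OF Suc.prems(1), symmetric] map_upt_Suc
        del: upt_Suc)
  moreover have "(\<Sum>b\<in>Basis. (g' 0 \<bullet> b) * F (b # ?vs t)
        + (\<Sum>i<k. F (b # (?vs t)[i := g' (Suc i)])) * (g 0 t \<bullet> b)) =
      (\<Sum>i<Suc k. F ((map (\<lambda>i. g i t) [0..<Suc k])[i := g' i]))"
  proof -
    \<comment> \<open>With the sums exchanged, the inner sum over \<open>Basis\<close> reassembles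
      \<open>g 0 t\<close> in the first slot for each differentiated slot \<open>i\<close>.\<close>
    have "(\<Sum>b\<in>Basis. (\<Sum>i<k. F (b # (?vs t)[i := g' (Suc i)])) * (g 0 t \<bullet> b)) =
        (\<Sum>i<k. \<Sum>b\<in>Basis. (g 0 t \<bullet> b) * F (b # (?vs t)[i := g' (Suc i)]))"
      by (subst sum.swap) (simp add: sum_distrib_left mult.commute)
    then show ?thesis
      by (simp add: sum.distrib sum.lessThan_Suc_shift map_upt_Suc
          multilinear_form_Cons_expand[OF Suc.prems(1), symmetric] del: upt_Suc sum.lessThan_Suc)
  qed
  ultimately show ?case by simp
qed

section \<open>Calculus of matrix-valued curves\<close>

lemma bounded_bilinear_matrix_mult:
  "bounded_bilinear ((**) :: real^'n^'m \<Rightarrow> real^'p^'n \<Rightarrow> real^'p^'m)"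
proof -
  have "bilinear ((**) :: real^'n^'m \<Rightarrow> real^'p^'n \<Rightarrow> real^'p^'m)"
    unfolding bilinear_def
    by (auto intro!: linearI simp: matrix_matrix_mult_def vec_eq_iff algebra_simps sum.distrib
        sum_distrib_left)
  then show ?thesis by (simp add: bilinear_conv_bounded_bilinear)
qed

lemma bounded_linear_transpose: "bounded_linear (transpose :: real^'n^'m \<Rightarrow> real^'m^'n)"
  by (simp add: linear_conv_bounded_linear[symmetric] linear_iff transpose_def vec_eq_iff)

lemma bounded_linear_matrix_vector_mult_left: "bounded_linear (\<lambda>A :: real^'n^'m. A *v v)"
  by (simp add: linear_conv_bounded_linear[symmetric] linear_iff matrix_vector_mult_add_rdistrib
      scaleR_matrix_vector_assoc)

lemma has_vector_derivative_matrixI: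
  fixes f :: "real \<Rightarrow> real^'n^'m"
  assumes "\<And>i j. ((\<lambda>s. f s $ i $ j) has_real_derivative f' $ i $ j) (at t)"
  shows "(f has_vector_derivative f') (at t)"
  unfolding has_vector_derivative_def
proof (subst has_derivative_componentwise_within, intro ballI)
  fix b :: "real^'n^'m" assume "b \<in> Basis"
  then obtain i j where "b = axis i (axis j 1)"
    by (auto simp: Basis_vec_def)
  then show "((\<lambda>x. f x \<bullet> b) has_derivative (\<lambda>x. (x *\<^sub>R f') \<bullet> b)) (at t)"
    using assms[of i j] by (simp add: inner_axis has_field_derivative_def mult_commute_abs)
qed

text \<open>For \<open>\<gamma> t = mat 1\<close> the right-hand side is the infinitesimal action of
  \<open>\<gamma>'\<close> on \<open>F\<close>. For an exponential curve it is that action evaluated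
  on the moved tuple.\<close>

lemma multilinear_form_linear_image_derivative:
  fixes \<gamma> :: "real \<Rightarrow> real^'n^'n"
  assumes "multilinear_form k F" and "length vs = k"
    and "(\<gamma> has_vector_derivative \<gamma>') (at t)"
  shows "((\<lambda>s. F (map ((*v) (\<gamma> s)) vs)) has_real_derivative
          (\<Sum>i<k. F ((map ((*v) (\<gamma> t)) vs)[i := \<gamma>' *v vs ! i]))) (at t)"
proof -
  have "map (\<lambda>i. \<gamma> s *v vs ! i) [0..<k] = map ((*v) (\<gamma> s)) vs" for s
    using assms(2) by (auto intro: nth_equalityI)
  moreover have "((\<lambda>s. \<gamma> s *v vs ! i) has_vector_derivative \<gamma>' *v vs ! i) (at t)" for i
    by (rule bounded_linear.has_vector_derivative[OF bounded_linear_matrix_vector_mult_left assms(3)])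
  ultimately show ?thesis
    using multilinear_form_has_real_derivative[OF assms(1), of "\<lambda>i s. \<gamma> s *v vs ! i" "\<lambda>i. \<gamma>' *v vs ! i"]
    by simp
qed

subsection \<open>The matrix exponential\<close>

primrec matrix_power :: "real^'n^'n \<Rightarrow> nat \<Rightarrow> real^'n^'n" where
  "matrix_power X 0 = mat 1"
| "matrix_power X (Suc m) = X ** matrix_power X m"

lemma matrix_power_commute: "matrix_power X m ** X = X ** matrix_power X m"
  by (induction m) (simp_all flip: matrix_mul_assoc)

text \<open>The sum of the absolute values of all entries is a submultiplicative norm that dominates
  every entry.\<close>

lemma matrix_power_bound:
  "\<bar>matrix_power X m $ i $ j\<bar> \<le> (\<Sum>a\<in>UNIV. \<Sum>b\<in>UNIV. \<bar>X $ a $ b\<bar>) ^ m"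
proof (induction m arbitrary: i)
  case 0
  show ?case by (simp add: mat_def)
next
  case (Suc m)
  let ?K = "\<Sum>a\<in>UNIV. \<Sum>b\<in>UNIV. \<bar>X $ a $ b\<bar>"
  have K: "0 \<le> ?K" by (intro sum_nonneg) auto
  have "\<bar>matrix_power X (Suc m) $ i $ j\<bar> \<le> (\<Sum>l\<in>UNIV. \<bar>X $ i $ l\<bar> * \<bar>matrix_power X m $ l $ j\<bar>)"
    by (simp add: matrix_matrix_mult_def abs_mult[symmetric] sum_abs)
  also have "\<dots> \<le> (\<Sum>l\<in>UNIV. \<bar>X $ i $ l\<bar> * ?K ^ m)"
    by (intro sum_mono mult_left_mono Suc) auto
  also have "\<dots> = (\<Sum>l\<in>UNIV. \<bar>X $ i $ l\<bar>) * ?K ^ m" by (simp add: sum_distrib_right)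
  \<comment> \<open>The absolute sum of row \<open>i\<close> is one of the nonnegative row sums that
    make up \<open>?K\<close>.\<close>
  also have "\<dots> \<le> ?K * ?K ^ m"
    using K by (intro mult_right_mono member_le_sum sum_nonneg) auto
  finally show ?case by simp
qed

text \<open>\<open>t \<mapsto> exp (tX)\<close>, given entrywise because square matrices carry no Banach algebra structure
  in the library.\<close>

definition matrix_exp :: "real^'n^'n \<Rightarrow> real \<Rightarrow> real^'n^'n" where
  "matrix_exp X t = (\<chi> i j. \<Sum>m. matrix_power X m $ i $ j / fact m * t ^ m)"

lemma summable_matrix_exp: "summable (\<lambda>m. matrix_power X m $ i $ j / fact m * t ^ m)"
proof (rule summable_comparison_test')
  let ?K = "\<Sum>a\<in>UNIV. \<Sum>b\<in>UNIV. \<bar>X $ a $ b\<bar>"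
  show "summable (\<lambda>m. inverse (fact m) * (?K * \<bar>t\<bar>) ^ m)"
    by (rule summable_exp)
  show "norm (matrix_power X m $ i $ j / fact m * t ^ m) \<le> inverse (fact m) * (?K * \<bar>t\<bar>) ^ m"
    if "0 \<le> m" for m
    using mult_right_mono[OF matrix_power_bound[of X m i j], of "\<bar>t\<bar> ^ m / fact m"]
    by (simp add: abs_mult power_abs power_mult_distrib field_simps)
qed

lemma matrix_exp_0 [simp]: "matrix_exp X 0 = mat 1"
proof -
  have "(\<Sum>m. matrix_power X m $ i $ j / fact m * 0 ^ m) = mat 1 $ i $ j" for i j
    using powser_zero[of "\<lambda>m. matrix_power X m $ i $ j / fact m"] by simp
  then show ?thesis by (simp add: matrix_exp_def vec_eq_iff)
qed

lemma matrix_exp_has_vector_derivative: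
  "(matrix_exp X has_vector_derivative X ** matrix_exp X t) (at t)"
proof (rule has_vector_derivative_matrixI)
  fix i j
  let ?c = "\<lambda>i m. matrix_power X m $ i $ j / fact m"
  \<comment> \<open>The factor \<open>Suc m\<close> from \<open>diffs\<close> cancels against
    \<open>fact (Suc m)\<close>, leaving one factor \<open>X\<close> on the left of the
    \<open>m\<close>-th term.\<close>
  have "diffs (?c i) m * t ^ m = (\<Sum>l\<in>UNIV. X $ i $ l * (?c l m * t ^ m))" for m
    by (simp add: diffs_def matrix_matrix_mult_def sum_distrib_left sum_distrib_right
        sum_divide_distrib fact_Suc field_simps del: of_nat_Suc)
  moreover have "(\<lambda>m. \<Sum>l\<in>UNIV. X $ i $ l * (?c l m * t ^ m)) sums
      (\<Sum>l\<in>UNIV. X $ i $ l * (\<Sum>m. ?c l m * t ^ m))"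
    by (intro sums_sum sums_mult summable_sums summable_matrix_exp)
  ultimately have "(\<Sum>m. diffs (?c i) m * t ^ m) = (X ** matrix_exp X t) $ i $ j"
    by (simp add: sums_unique[symmetric] matrix_matrix_mult_def matrix_exp_def)
  then show "((\<lambda>s. matrix_exp X s $ i $ j) has_real_derivative (X ** matrix_exp X t) $ i $ j) (at t)"
    using termdiffs_strong_converges_everywhere[OF summable_matrix_exp, of X i j t]
    by (simp add: matrix_exp_def)
qed

lemma smooth_curve_on_matrix_exp: "smooth_curve_on T (matrix_exp X)"
  unfolding smooth_curve_on_def
\<comment> \<open>The \<open>m\<close>-th derivative of \<open>exp (tX)\<close> is
  \<open>X^m exp (tX)\<close>.\<close>
proof (intro exI[of _ "\<lambda>m t. matrix_power X m ** matrix_exp X t"] conjI allI ballI)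
  show "(\<lambda>t. matrix_power X 0 ** matrix_exp X t) = matrix_exp X" by simp
  fix m t
  have "((\<lambda>t. matrix_power X m ** matrix_exp X t) has_vector_derivative
      matrix_power X m ** (X ** matrix_exp X t)) (at t)"
    by (rule bounded_linear.has_vector_derivative[OF
          bounded_bilinear.bounded_linear_right[OF bounded_bilinear_matrix_mult]
          matrix_exp_has_vector_derivative])
  then show "((\<lambda>t. matrix_power X m ** matrix_exp X t) has_vector_derivative
      matrix_power X (Suc m) ** matrix_exp X t) (at t)"
    by (simp add: matrix_mul_assoc matrix_power_commute)
qed

section \<open>Bilinear forms preserved by one-parameter groups\<close>

lemma quadratic_curve_derivative:
  fixes \<gamma> :: "real \<Rightarrow> real^'n^'n" and S :: "real^'n^'n"
  assumes "(\<gamma> has_vector_derivative \<gamma>') (at t)"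
  shows "((\<lambda>s. transpose (\<gamma> s) ** S ** \<gamma> s) has_vector_derivative
          transpose (\<gamma> t) ** S ** \<gamma>' + transpose \<gamma>' ** S ** \<gamma> t) (at t)"
proof -
  have lin: "bounded_linear (\<lambda>A :: real^'n^'n. transpose A ** S)"
    using bounded_linear_compose[OF bounded_bilinear.bounded_linear_left[OF
          bounded_bilinear_matrix_mult] bounded_linear_transpose] .
  have "((\<lambda>s. transpose (\<gamma> s) ** S) has_vector_derivative transpose \<gamma>' ** S) (at t)"
    using lin assms by (rule bounded_linear.has_vector_derivative)
  then show ?thesis
    using assms by (rule bounded_bilinear.has_vector_derivative[OF bounded_bilinear_matrix_mult])
qed

text \<open>With \<open>E = exp (tX)\<close>, the derivative of \<open>E^T S E\<close> is
  \<open>E^T (X^T S + S X) E = 0\<close>, so the value at 0 persists. Taking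
  \<open>S = mat 1\<close> gives orthogonality; taking \<open>S\<close> to be the reflection later
  gives commutation with it.\<close>

lemma matrix_exp_preserves_bilinear_form:
  assumes "transpose X ** S + S ** X = 0"
  shows "transpose (matrix_exp X t) ** S ** matrix_exp X t = S"
proof -
  let ?f = "\<lambda>s. transpose (matrix_exp X s) ** S ** matrix_exp X s"
  have "(?f has_vector_derivative 0) (at s)" for s
  proof -
    let ?E = "matrix_exp X s"
    have "transpose ?E ** S ** (X ** ?E) + transpose (X ** ?E) ** S ** ?E =
        transpose ?E ** (transpose X ** S + S ** X) ** ?E"
      by (simp add: matrix_transpose_mul matrix_mul_assoc matrix_add_ldistrib
          bounded_bilinear.add_left[OF bounded_bilinear_matrix_mult])
    then show ?thesis
      using quadratic_curve_derivative[OF matrix_exp_has_vector_derivative, of X S s] assms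
      by simp
  qed
  then have "?f t = ?f 0"
    by (intro has_derivative_zero_unique[of UNIV]) (auto simp: has_vector_derivative_def)
  then show ?thesis by simp
qed

text \<open>Orthogonality leaves only the determinants 1 and -1; by continuity in \<open>t\<close>
  the determinant keeps its value 1 at 0.\<close>

lemma rotation_matrix_matrix_exp:
  assumes "transpose X = - X"
  shows "rotation_matrix (matrix_exp X t)"
proof -
  have orth: "orthogonal_matrix (matrix_exp X s)" for s
    using matrix_exp_preserves_bilinear_form[of X "mat 1" s] assms
    by (simp add: orthogonal_matrix)
  have "continuous_on UNIV (\<lambda>s. matrix_exp X s)"
    by (meson continuous_at_imp_continuous_on has_vector_derivative_continuous
        matrix_exp_has_vector_derivative)
  then have "continuous_on UNIV (\<lambda>s. det (matrix_exp X s))"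
    unfolding det_def by (intro continuous_intros)
  then have "(\<lambda>s. det (matrix_exp X s)) constant_on UNIV"
  proof (rule continuous_discrete_range_constant[OF connected_UNIV])
    fix s
    \<comment> \<open>Distinct values are 1 and -1, at distance 2, so 1 serves as a uniform
      gap.\<close>
    have "1 \<le> norm (det (matrix_exp X r) - det (matrix_exp X s))"
      if "det (matrix_exp X r) \<noteq> det (matrix_exp X s)" for r
      using that det_orthogonal_matrix[OF orth[of r]] det_orthogonal_matrix[OF orth[of s]] by auto
    then show "\<exists>e>0. \<forall>r. r \<in> UNIV \<and> det (matrix_exp X r) \<noteq> det (matrix_exp X s) \<longrightarrow>
        e \<le> norm (det (matrix_exp X r) - det (matrix_exp X s))"
      by (intro exI[of _ 1]) auto
  qed
  then have "det (matrix_exp X t) = det (matrix_exp X 0)"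
    unfolding constant_on_def by (metis UNIV_I)
  then show ?thesis
    using orth by (simp add: rotation_matrix_def)
qed


subsection \<open>The Lie algebra of a common stabilizer\<close>

lemma skew_form_multilinear: "skew_form k \<alpha> \<Longrightarrow> multilinear_form k \<alpha>"
  by (auto simp: skew_form_def multilinear_form_def)

text \<open>For a multilinear form this is the derivative at \<open>s = 0\<close> of
  \<open>pullback (exp (sX)) \<alpha>\<close>, that is, \<open>X\<close> acting as a
  derivation.\<close>

definition infinitesimal_action ::
  "real^'n^'n \<Rightarrow> ((real^'n) list \<Rightarrow> real) \<Rightarrow> (real^'n) list \<Rightarrow> real" where
  "infinitesimal_action X \<alpha> vs = (\<Sum>i<length vs. \<alpha> (vs[i := X *v vs ! i]))"

lemma infinitesimal_action_linear:
  assumes "multilinear_form k \<alpha>" and "length vs = k"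
  shows "linear (\<lambda>X. infinitesimal_action X \<alpha> vs)"
proof -
  have "linear (\<lambda>X. \<alpha> (vs[i := X *v vs ! i]))" if "i < k" for i
    using linear_compose[OF bounded_linear.linear[OF bounded_linear_matrix_vector_mult_left]
        multilinear_form_linear[OF assms that]]
    by (simp add: o_def)
  then show ?thesis
    unfolding infinitesimal_action_def using assms(2) by (intro linear_compose_sum) auto
qed

text \<open>The infinitesimal version of \<open>common_stabilizer\<close>, with \<open>d\<close>
  giving the degrees. It is cut out by linear equations, so it is visibly a subspace, unlike a set
  of velocities of curves.\<close>

definition stabilizer_algebra ::
  "nat \<Rightarrow> (nat \<Rightarrow> nat) \<Rightarrow> (nat \<Rightarrow> (real^'n) list \<Rightarrow> real) \<Rightarrow> (real^'n^'n) set" where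
  "stabilizer_algebra N d \<alpha> = {X. transpose X = - X \<and>
     (\<forall>j \<le> N. \<forall>vs. length vs = d j \<longrightarrow> infinitesimal_action X (\<alpha> j) vs = 0)}"

lemma subspace_stabilizer_algebra:
  assumes "\<And>j. j \<le> N \<Longrightarrow> skew_form (d j) (\<alpha> j)"
  shows "subspace (stabilizer_algebra N d \<alpha>)"
proof -
  have lin: "linear (\<lambda>X. infinitesimal_action X (\<alpha> j) vs)" if "j \<le> N" "length vs = d j" for j vs
    using infinitesimal_action_linear[OF skew_form_multilinear[OF assms]] that by blast
  have tr: "linear (transpose :: real^'n^'n \<Rightarrow> _)"
    using bounded_linear_transpose by (rule bounded_linear.linear)
  show ?thesis
    by (auto simp: subspace_def stabilizer_algebra_def lin[THEN linear_0] lin[THEN linear_add]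
        lin[THEN linear_scale] linear_0[OF tr] linear_add[OF tr] linear_scale[OF tr])
qed

lemma lie_algebraE:
  assumes "X \<in> lie_algebra G"
  obtains \<gamma> e where "e > 0" "\<And>t. t \<in> {-e<..<e} \<Longrightarrow> \<gamma> t \<in> G" "\<gamma> 0 = mat 1"
    "(\<gamma> has_vector_derivative X) (at 0)"
  using assms unfolding lie_algebra_def mem_Collect_eq by metis

text \<open>Along a curve in \<open>G\<close> the product \<open>\<gamma>^T \<gamma>\<close> is
  constantly the identity; its derivative at 0 is \<open>X + X^T\<close>.\<close>

lemma lie_algebra_imp_skew:
  assumes "\<And>P. P \<in> G \<Longrightarrow> orthogonal_matrix P" and "X \<in> lie_algebra G"
  shows "transpose X = - X"
proof -
  obtain \<gamma> e where e: "e > 0" "\<And>t. t \<in> {-e<..<e} \<Longrightarrow> \<gamma> t \<in> G" "\<gamma> 0 = mat 1"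
    "(\<gamma> has_vector_derivative X) (at 0)"
    using assms(2) by (rule lie_algebraE) metis
  have "((\<lambda>s. transpose (\<gamma> s) ** mat 1 ** \<gamma> s) has_vector_derivative X + transpose X) (at 0)"
    using quadratic_curve_derivative[OF e(4), of "mat 1"] e(3) by simp
  moreover have "((\<lambda>s. transpose (\<gamma> s) ** mat 1 ** \<gamma> s) has_vector_derivative 0) (at 0)"
    using has_vector_derivative_const
    by (rule has_vector_derivative_transform_within_open[where S = "{-e<..<e}" and f = "\<lambda>_. mat 1"])
      (use e(1,2) assms(1) in \<open>auto simp: orthogonal_matrix\<close>)
  ultimately have "X + transpose X = 0"
    by (rule vector_derivative_unique_at)
  then show ?thesis
    by (simp add: eq_neg_iff_add_eq_0 add.commute)
qed

lemma lie_algebra_imp_commutes: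
  assumes "\<And>P. P \<in> G \<Longrightarrow> P ** A = A ** P" and "X \<in> lie_algebra G"
  shows "X ** A = A ** X"
proof -
  obtain \<gamma> e where e: "e > 0" "\<And>t. t \<in> {-e<..<e} \<Longrightarrow> \<gamma> t \<in> G"
    "(\<gamma> has_vector_derivative X) (at 0)"
    using assms(2) by (rule lie_algebraE) metis
  have "((\<lambda>s. \<gamma> s ** A) has_vector_derivative X ** A) (at 0)"
    using bounded_bilinear.bounded_linear_left[OF bounded_bilinear_matrix_mult] e(3)
    by (rule bounded_linear.has_vector_derivative)
  then have "((\<lambda>s. A ** \<gamma> s) has_vector_derivative X ** A) (at 0)"
    by (rule has_vector_derivative_transform_within_open[where S = "{-e<..<e}"])
      (use e(1,2) assms(1) in auto)
  moreover have "((\<lambda>s. A ** \<gamma> s) has_vector_derivative A ** X) (at 0)"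
    using bounded_bilinear.bounded_linear_right[OF bounded_bilinear_matrix_mult] e(3)
    by (rule bounded_linear.has_vector_derivative)
  ultimately show ?thesis
    by (rule vector_derivative_unique_at)
qed

lemma lie_algebra_mono: "G \<subseteq> H \<Longrightarrow> lie_algebra G \<subseteq> lie_algebra H"
  unfolding lie_algebra_def by blast

text \<open>The exponential is the witness curve throughout; the interval of radius 1 is an
  arbitrary choice.\<close>

lemma lie_algebraI_matrix_exp:
  assumes "\<And>t. matrix_exp X t \<in> G"
  shows "X \<in> lie_algebra G"
  unfolding lie_algebra_def
proof (safe intro!: exI[of _ "matrix_exp X"] exI[of _ "1::real"])
  show "(matrix_exp X has_vector_derivative X) (at 0)"
    using matrix_exp_has_vector_derivative[of X 0] by simp
qed (use assms smooth_curve_on_matrix_exp in auto)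

text \<open>Each \<open>\<alpha> j\<close> is constant along the moved tuple near 0, and its
  derivative there is the infinitesimal action.\<close>

lemma lie_algebra_common_stabilizer_subset:
  assumes "\<And>j. j \<le> N \<Longrightarrow> skew_form (d j) (\<alpha> j)"
  shows "lie_algebra (common_stabilizer N \<alpha>) \<subseteq> stabilizer_algebra N d \<alpha>"
proof
  fix X assume X: "X \<in> lie_algebra (common_stabilizer N \<alpha>)"
  then obtain \<gamma> e where e: "e > 0" "\<And>t. t \<in> {-e<..<e} \<Longrightarrow> \<gamma> t \<in> common_stabilizer N \<alpha>"
    "\<gamma> 0 = mat 1" "(\<gamma> has_vector_derivative X) (at 0)"
    by (rule lie_algebraE) metis
  have "infinitesimal_action X (\<alpha> j) vs = 0" if j: "j \<le> N" "length vs = d j" for j vs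
  proof -
    have "((\<lambda>s. \<alpha> j (map ((*v) (\<gamma> s)) vs)) has_vector_derivative infinitesimal_action X (\<alpha> j) vs) (at 0)"
      using multilinear_form_linear_image_derivative[OF
          skew_form_multilinear[OF assms[OF j(1)]] j(2) e(4)] e(3) j(2)
      by (simp add: has_real_derivative_iff_has_vector_derivative infinitesimal_action_def
          matrix_vector_mul_lid[abs_def])
    moreover have "((\<lambda>s. \<alpha> j (map ((*v) (\<gamma> s)) vs)) has_vector_derivative 0) (at 0)"
      using has_vector_derivative_const
    proof (rule has_vector_derivative_transform_within_open[where S = "{-e<..<e}"])
      fix s assume "s \<in> {-e<..<e}"
      then have "pullback (\<gamma> s) (\<alpha> j) = \<alpha> j"
        using e(2) j(1) by (auto simp: common_stabilizer_def)
      then show "\<alpha> j vs = \<alpha> j (map ((*v) (\<gamma> s)) vs)"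
        by (metis pullback_def)
    qed (use e(1) in auto)
    ultimately show ?thesis
      by (rule vector_derivative_unique_at)
  qed
  moreover have "transpose X = - X"
    using X by (rule lie_algebra_imp_skew[rotated])
      (auto simp: common_stabilizer_def rotation_matrix_def)
  ultimately show "X \<in> stabilizer_algebra N d \<alpha>"
    by (simp add: stabilizer_algebra_def)
qed

text \<open>The infinitesimal action vanishes on all tuples of the right length, in particular on
  the tuple moved to time \<open>s\<close>. Hence the derivative is zero at every time and the form
  stays constant.\<close>

lemma matrix_exp_in_common_stabilizer:
  assumes forms: "\<And>j. j \<le> N \<Longrightarrow> skew_form (d j) (\<alpha> j)"
    and X: "X \<in> stabilizer_algebra N d \<alpha>"
  shows "matrix_exp X t \<in> common_stabilizer N \<alpha>"
proof -
  have "pullback (matrix_exp X t) (\<alpha> j) vs = \<alpha> j vs" if j: "j \<le> N" for j vs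
  proof (cases "length vs = d j")
    case True
    let ?f = "\<lambda>s. \<alpha> j (map ((*v) (matrix_exp X s)) vs)"
    have "(?f has_real_derivative 0) (at s)" for s
    proof -
      let ?us = "map ((*v) (matrix_exp X s)) vs"
      have "(?f has_real_derivative infinitesimal_action X (\<alpha> j) ?us) (at s)"
        using multilinear_form_linear_image_derivative[OF
            skew_form_multilinear[OF forms[OF j]] True matrix_exp_has_vector_derivative, of X s] True
        by (simp add: infinitesimal_action_def matrix_vector_mul_assoc)
      then show ?thesis
        using X j True by (simp add: stabilizer_algebra_def)
    qed
    then have "?f t = ?f 0"
      by (intro DERIV_isconst_all) auto
    then show ?thesis
      by (simp add: pullback_def matrix_vector_mul_lid[abs_def])
  next
    \<comment> \<open>Forms vanish on tuples of the wrong length, and applying a matrix to each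
      entry keeps the length.\<close>
    case False
    then show ?thesis
      using forms[OF j] by (simp add: pullback_def skew_form_def)
  qed
  moreover have "rotation_matrix (matrix_exp X t)"
    using X by (intro rotation_matrix_matrix_exp) (simp add: stabilizer_algebra_def)
  ultimately show ?thesis
    by (auto simp: common_stabilizer_def)
qed

lemma lie_algebra_common_stabilizer:
  assumes "\<And>j. j \<le> N \<Longrightarrow> skew_form (d j) (\<alpha> j)"
  shows "lie_algebra (common_stabilizer N \<alpha>) = stabilizer_algebra N d \<alpha>"
proof
  show "lie_algebra (common_stabilizer N \<alpha>) \<subseteq> stabilizer_algebra N d \<alpha>"
    using assms by (rule lie_algebra_common_stabilizer_subset)
  show "stabilizer_algebra N d \<alpha> \<subseteq> lie_algebra (common_stabilizer N \<alpha>)"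
    using assms by (blast intro: lie_algebraI_matrix_exp matrix_exp_in_common_stabilizer)
qed

subsection \<open>The reflection in a plane\<close>

lemma inner_matrix_mult_left:
  fixes A :: "real^'n^'m"
  shows "(A ** X) \<bullet> Y = X \<bullet> (transpose A ** Y)"
proof -
  have "(A ** X) \<bullet> Y = (\<Sum>i\<in>UNIV. \<Sum>j\<in>UNIV. \<Sum>k\<in>UNIV. A $ i $ k * X $ k $ j * Y $ i $ j)"
    by (simp add: inner_vec_def matrix_matrix_mult_def sum_distrib_right)
  also have "\<dots> = (\<Sum>i\<in>UNIV. \<Sum>k\<in>UNIV. \<Sum>j\<in>UNIV. A $ i $ k * X $ k $ j * Y $ i $ j)"
    by (intro sum.cong refl sum.swap)
  also have "\<dots> = (\<Sum>k\<in>UNIV. \<Sum>i\<in>UNIV. \<Sum>j\<in>UNIV. A $ i $ k * X $ k $ j * Y $ i $ j)"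
    by (rule sum.swap)
  also have "\<dots> = (\<Sum>k\<in>UNIV. \<Sum>j\<in>UNIV. \<Sum>i\<in>UNIV. A $ i $ k * X $ k $ j * Y $ i $ j)"
    by (intro sum.cong refl sum.swap)
  also have "\<dots> = X \<bullet> (transpose A ** Y)"
    by (simp add: inner_vec_def matrix_matrix_mult_def transpose_def sum_distrib_left mult_ac)
  finally show ?thesis .
qed

lemma inner_transpose: "transpose X \<bullet> transpose Y = X \<bullet> (Y :: real^'n^'m)"
  unfolding inner_vec_def transpose_def inner_real_def by simp (rule sum.swap)

text \<open>Transposition is an isometry that exchanges left and right multiplication, so this
  reduces to the left-hand version.\<close>

lemma inner_matrix_mult_right:
  fixes B :: "real^'p^'n"
  shows "(X ** B) \<bullet> Y = X \<bullet> (Y ** transpose B)"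
proof -
  have "(X ** B) \<bullet> Y = (transpose B ** transpose X) \<bullet> transpose Y"
    by (metis inner_transpose matrix_transpose_mul)
  also have "\<dots> = transpose X \<bullet> (B ** transpose Y)"
    by (simp add: inner_matrix_mult_left)
  also have "\<dots> = X \<bullet> (Y ** transpose B)"
    by (metis inner_transpose matrix_transpose_mul transpose_transpose)
  finally show ?thesis .
qed

section \<open>Bivectors as skew operators\<close>

lemma wedge_mult_vector: "wedge u v *v y = (v \<bullet> y) *\<^sub>R u - (u \<bullet> y) *\<^sub>R v"
proof -
  have "(wedge u v *v y) $ i = (v \<bullet> y) * u $ i - (u \<bullet> y) * v $ i" for i
    by (simp add: wedge_def matrix_vector_mult_def inner_vec_def algebra_simps sum_subtractf
        sum_distrib_left)
  then show ?thesis by (simp add: vec_eq_iff)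
qed

lemma transpose_wedge: "transpose (wedge u v) = - wedge u v"
  by (simp add: wedge_def transpose_def vec_eq_iff)

lemma wedge_anticommute: "wedge u v = - wedge v u"
  by (simp add: wedge_def vec_eq_iff)

lemma matrix_vector_mult_minus_left: "(- A) *v x = - (A *v (x :: real^'n))"
  by (simp add: matrix_vector_mult_def vec_eq_iff sum_negf)

lemma matrix_vector_mult_minus_right: "A *v (- x) = - (A *v (x :: real^'n))"
  by (simp add: matrix_vector_mult_def vec_eq_iff sum_negf)

lemma inner_matrix_vector_mult:
  fixes A :: "real^'n^'m"
  shows "(A *v u) \<bullet> v = u \<bullet> (transpose A *v v)"
  by (metis dot_lmul_matrix inner_commute transpose_matrix_vector)

lemma skew_inner:
  fixes X :: "real^'n^'n"
  assumes "transpose X = - X"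
  shows "(X *v u) \<bullet> v = - (u \<bullet> (X *v v))"
  by (simp add: assms inner_matrix_vector_mult matrix_vector_mult_minus_left
      del: transpose_matrix_vector)

text \<open>The action on \<open>W\<close> and on its orthogonal complement determines
  \<open>\<phi>\<close>, because the two together span the space. No basis or block form is
  chosen.\<close>

locale plane_reflection =
  fixes W :: "(real^'n) set" and \<phi> :: "real^'n^'n"
  assumes subspace_W: "subspace W"
    and fix_W: "w \<in> W \<Longrightarrow> \<phi> *v w = w"
    and negate_perp: "x \<in> W\<^sup>\<bottom> \<Longrightarrow> \<phi> *v x = - x"
begin

lemma decompose:
  obtains w x where "w \<in> W" "x \<in> W\<^sup>\<bottom>" "v = w + x"
  using subspace_sum_orthogonal_comp[OF subspace_W] by (metis UNIV_I set_plus_elim)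

lemma perpD: "w \<in> W \<Longrightarrow> x \<in> W\<^sup>\<bottom> \<Longrightarrow> w \<bullet> x = 0"
  by (simp add: orthogonal_comp_def orthogonal_def)

lemma reflect_sum: "w \<in> W \<Longrightarrow> x \<in> W\<^sup>\<bottom> \<Longrightarrow> \<phi> *v (w + x) = w - x"
  by (simp add: matrix_vector_right_distrib fix_W negate_perp)

lemma involution: "\<phi> ** \<phi> = mat 1"
proof -
  have "\<phi> *v (\<phi> *v v) = v" for v
  proof -
    obtain w x where "w \<in> W" "x \<in> W\<^sup>\<bottom>" "v = w + x" by (rule decompose)
    then show ?thesis
      by (simp add: reflect_sum matrix_vector_mult_diff_distrib fix_W negate_perp)
  qed
  then show ?thesis by (simp add: matrix_eq flip: matrix_vector_mul_assoc)
qed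

lemma involution_vector [simp]: "\<phi> *v (\<phi> *v v) = v"
  by (simp add: matrix_vector_mul_assoc involution)

lemma reflect_inner: "(\<phi> *v u) \<bullet> v = u \<bullet> (\<phi> *v v)"
proof -
  obtain w x where "w \<in> W" "x \<in> W\<^sup>\<bottom>" "u = w + x" by (rule decompose)
  moreover obtain w' x' where "w' \<in> W" "x' \<in> W\<^sup>\<bottom>" "v = w' + x'" by (rule decompose)
  ultimately show ?thesis
    by (simp add: reflect_sum inner_simps perpD inner_commute[of x])
qed

lemma transpose_reflection: "transpose \<phi> = \<phi>"
proof -
  have "(transpose \<phi> *v u) \<bullet> v = (\<phi> *v u) \<bullet> v" for u v
    by (simp add: dot_lmul_matrix reflect_inner)
  then show ?thesis
    by (metis matrix_eq vector_eq_rdot)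
qed

text \<open>Together with \<open>negated_iff\<close> this makes \<open>W\<close> and its complement
  the eigenspaces of \<open>\<phi>\<close>, so that membership becomes an equation.\<close>

lemma fixed_iff: "\<phi> *v v = v \<longleftrightarrow> v \<in> W"
proof
  assume *: "\<phi> *v v = v"
  obtain w x where v: "w \<in> W" "x \<in> W\<^sup>\<bottom>" "v = w + x" by (rule decompose)
  then have "2 *\<^sub>R x = 0"
    using * reflect_sum[of w x] by (simp add: scaleR_2 algebra_simps)
  then show "v \<in> W" using v by simp
qed (rule fix_W)

lemma negated_iff: "\<phi> *v v = - v \<longleftrightarrow> v \<in> W\<^sup>\<bottom>"
proof
  assume *: "\<phi> *v v = - v"
  obtain w x where v: "w \<in> W" "x \<in> W\<^sup>\<bottom>" "v = w + x" by (rule decompose)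
  then have "2 *\<^sub>R w = 0"
    using * reflect_sum[of w x] by (simp add: scaleR_2 algebra_simps)
  then show "v \<in> W\<^sup>\<bottom>" using v by simp
qed (rule negate_perp)

text \<open>An orthogonal \<open>P\<close> preserving \<open>W\<close> also preserves the
  complement, hence both eigenspaces of \<open>\<phi>\<close>; a matrix commuting with
  \<open>\<phi>\<close> preserves its eigenspaces. The commutation equation can be differentiated
  along curves.\<close>

lemma orthogonal_preserves_iff_commutes:
  assumes "orthogonal_matrix P"
  shows "(*v) P ` W = W \<longleftrightarrow> P ** \<phi> = \<phi> ** P"
proof
  assume PW: "(*v) P ` W = W"
  have iso: "(P *v u) \<bullet> (P *v v) = u \<bullet> v" for u v
    using assms by (simp add: inner_matrix_vector_mult orthogonal_matrix matrix_vector_mul_assoc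
        del: transpose_matrix_vector)
  have perp: "P *v x \<in> W\<^sup>\<bottom>" if "x \<in> W\<^sup>\<bottom>" for x
    unfolding orthogonal_comp_def orthogonal_def
  proof (intro CollectI ballI)
    fix y assume "y \<in> W"
    then obtain w where "w \<in> W" "y = P *v w" using PW by blast
    then show "y \<bullet> (P *v x) = 0" using that by (simp add: iso perpD)
  qed
  have "P *v (\<phi> *v v) = \<phi> *v (P *v v)" for v
  proof -
    obtain w x where v: "w \<in> W" "x \<in> W\<^sup>\<bottom>" "v = w + x" by (rule decompose)
    moreover have "P *v w \<in> W" using PW v(1) by blast
    ultimately show ?thesis
      using perp[of x] by (simp add: reflect_sum) (simp add: matrix_vector_right_distrib
          matrix_vector_mult_diff_distrib fix_W negate_perp)
  qed
  then show "P ** \<phi> = \<phi> ** P"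
    by (simp add: matrix_eq flip: matrix_vector_mul_assoc)
next
  assume comm: "P ** \<phi> = \<phi> ** P"
  have sub: "Q *v w \<in> W" if "Q ** \<phi> = \<phi> ** Q" "w \<in> W" for Q :: "real^'n^'n" and w
    using that by (metis fixed_iff matrix_vector_mul_assoc)
  \<comment> \<open>The inverse of \<open>P\<close> commutes with \<open>\<phi>\<close> too, so it
    maps \<open>W\<close> into itself. This gives the reverse inclusion.\<close>
  have "transpose P ** \<phi> = \<phi> ** transpose P"
    using arg_cong[OF comm, of transpose] by (simp add: matrix_transpose_mul transpose_reflection)
  moreover have "P *v (transpose P *v w) = w" for w
    using assms by (metis matrix_vector_mul_assoc matrix_vector_mul_lid orthogonal_matrix_def)
  ultimately have "W \<subseteq> (*v) P ` W"
    using sub by (metis image_eqI subsetI)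
  then show "(*v) P ` W = W"
    using sub[OF comm] by blast
qed

section \<open>Conjugation by the reflection as a self-adjoint involution\<close>

lemma matrix_inv_reflection: "matrix_inv \<phi> = \<phi>"
proof -
  \<comment> \<open>\<open>matrix_inv\<close> is a choice of two-sided inverse;
    \<open>\<phi>\<close> itself witnesses that one exists.\<close>
  have "\<phi> ** matrix_inv \<phi> = mat 1"
    unfolding matrix_inv_def using involution by (metis (mono_tags, lifting) someI_ex)
  then show ?thesis
    by (metis involution matrix_mul_assoc matrix_mul_lid matrix_mul_rid)
qed

lemma Ad_reflection: "Ad \<phi> X = \<phi> ** X ** \<phi>"
  by (simp add: Ad_def matrix_inv_reflection)

lemma linear_Ad: "linear (Ad \<phi>)"
  unfolding Ad_reflection[abs_def]
  by (intro linearI) (simp_all add: bounded_bilinear.add_left[OF bounded_bilinear_matrix_mult]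
      bounded_bilinear.add_right[OF bounded_bilinear_matrix_mult]
      bounded_bilinear.scaleR_left[OF bounded_bilinear_matrix_mult]
      bounded_bilinear.scaleR_right[OF bounded_bilinear_matrix_mult])

lemma Ad_mult: "Ad \<phi> (X ** Y) = Ad \<phi> X ** Ad \<phi> Y"
  by (metis Ad_reflection involution matrix_mul_assoc matrix_mul_lid)

lemma Ad_involution: "Ad \<phi> (Ad \<phi> X) = X"
  by (metis Ad_reflection involution matrix_mul_assoc matrix_mul_lid matrix_mul_rid)

lemma Ad_inner: "Ad \<phi> X \<bullet> Y = X \<bullet> Ad \<phi> Y"
  by (simp only: Ad_reflection inner_matrix_mult_right[of "\<phi> ** X" \<phi>] inner_matrix_mult_left[of \<phi> X]
      transpose_reflection matrix_mul_assoc)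

lemma Ad_fixed_iff: "Ad \<phi> X = X \<longleftrightarrow> X ** \<phi> = \<phi> ** X"
  unfolding Ad_reflection by (metis involution matrix_mul_assoc matrix_mul_lid matrix_mul_rid)

lemma bij_betw_Ad_iff: "bij_betw (Ad \<phi>) S S \<longleftrightarrow> Ad \<phi> ` S = S"
  unfolding bij_betw_def by (metis Ad_involution inj_onI)

text \<open>\<open>Ad \<phi>\<close> is linear, multiplicative and injective on all matrices, so
  preservation of the set is the only real condition.\<close>

lemma restricts_to_lie_automorphism_iff:
  "restricts_to_lie_automorphism (Ad \<phi>) \<gg> \<longleftrightarrow> Ad \<phi> ` \<gg> = \<gg>"
  by (simp add: restricts_to_lie_automorphism_def bij_betw_Ad_iff bracket_def Ad_mult
      linear_add[OF linear_Ad] linear_diff[OF linear_Ad] linear_scale[OF linear_Ad])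

text \<open>Since \<open>\<phi>\<close> is orthogonal, conjugation takes \<open>wedge w x\<close> to
  the wedge of \<open>\<phi> *v w = w\<close> and \<open>\<phi> *v x = - x\<close>. The identity is
  checked on vectors.\<close>

lemma wedge_mixed:
  assumes "w \<in> W" "x \<in> W\<^sup>\<bottom>"
  shows "Ad \<phi> (wedge w x) = - wedge w x"
proof -
  have "Ad \<phi> (wedge w x) *v v = (- wedge w x) *v v" for v
  proof -
    have "Ad \<phi> (wedge w x) *v v = \<phi> *v (wedge w x *v (\<phi> *v v))"
      by (simp add: Ad_reflection flip: matrix_vector_mul_assoc)
    also have "\<dots> = (x \<bullet> (\<phi> *v v)) *\<^sub>R w + (w \<bullet> (\<phi> *v v)) *\<^sub>R x"
      using assms by (simp add: wedge_mult_vector matrix_vector_mult_diff_distrib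
          matrix_vector_mult_scaleR fix_W negate_perp)
    also have "\<dots> = (- wedge w x) *v v"
      using assms by (simp add: wedge_mult_vector matrix_vector_mult_minus_left fix_W negate_perp
          flip: reflect_inner)
    finally show ?thesis .
  qed
  then show ?thesis by (simp add: matrix_eq)
qed

lemma mixed_part_subset: "mixed_part W \<subseteq> {X. transpose X = - X \<and> Ad \<phi> X = - X}"
  unfolding mixed_part_def
proof (rule span_minimal)
  have tr: "linear (transpose :: real^'n^'n \<Rightarrow> _)"
    using bounded_linear_transpose by (rule bounded_linear.linear)
  show "subspace {X. transpose X = - X \<and> Ad \<phi> X = - X}"
    by (auto simp: subspace_def linear_0[OF tr] linear_add[OF tr] linear_scale[OF tr]
        linear_0[OF linear_Ad] linear_add[OF linear_Ad] linear_scale[OF linear_Ad])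
qed (auto simp: transpose_wedge wedge_mixed)

text \<open>If \<open>X\<close> is skew and exchanges \<open>W\<close> and \<open>W\<^sup>\<bottom>\<close>, then \<open>X = \<Sum>\<^sub>b (X b) \<and> b\<close> over an orthonormal
  basis of \<open>W\<close>.\<close>

lemma mixed_part_supset:
  assumes skew: "transpose X = - X" and anti: "Ad \<phi> X = - X"
  shows "X \<in> mixed_part W"
proof -
  obtain B where B: "B \<subseteq> W" "pairwise orthogonal B" "\<And>b. b \<in> B \<Longrightarrow> norm b = 1"
    "independent B" "span B = W"
    using orthonormal_basis_subspace[OF subspace_W] by metis
  have fin: "finite B" using B(4) by (rule independent_imp_finite)
  have "\<phi> ** X = - (X ** \<phi>)"
  proof -
    have "Ad \<phi> X ** \<phi> = \<phi> ** X"
      by (metis Ad_reflection involution matrix_mul_assoc matrix_mul_rid)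
    then show ?thesis
      by (simp add: anti bounded_bilinear.minus_left[OF bounded_bilinear_matrix_mult])
  qed
  then have anti_vec: "\<phi> *v (X *v v) = - (X *v (\<phi> *v v))" for v
    by (simp add: matrix_vector_mul_assoc matrix_vector_mult_minus_left)
  \<comment> \<open>Anticommuting with \<open>\<phi>\<close> means exchanging its two
    eigenspaces.\<close>
  have XW: "X *v w \<in> W\<^sup>\<bottom>" if "w \<in> W" for w
    using that by (simp add: anti_vec fix_W flip: negated_iff)
  have Xperp: "X *v x \<in> W" if "x \<in> W\<^sup>\<bottom>" for x
    using that by (simp add: anti_vec negate_perp matrix_vector_mult_minus_right flip: fixed_iff)
  let ?Y = "\<Sum>b\<in>B. wedge (X *v b) b"
  have Y: "?Y *v v = (\<Sum>b\<in>B. (b \<bullet> v) *\<^sub>R (X *v b)) - (\<Sum>b\<in>B. ((X *v b) \<bullet> v) *\<^sub>R b)" for v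
    by (simp add: bounded_linear.linear[OF bounded_linear_matrix_vector_mult_left, THEN linear_sum]
        wedge_mult_vector sum_subtractf)
  have "X *v v = ?Y *v v" for v
  proof -
    obtain w x where v: "w \<in> W" "x \<in> W\<^sup>\<bottom>" "v = w + x" by (rule decompose)
    have "(\<Sum>b\<in>B. (b \<bullet> v) *\<^sub>R (X *v b)) = X *v (\<Sum>b\<in>B. (w \<bullet> b) *\<^sub>R b)"
    proof -
      \<comment> \<open>Only the \<open>W\<close>-component of \<open>v\<close> pairs with
        \<open>b\<close>, so this sum recovers \<open>X *v w\<close>; the second sum will account
        for \<open>X *v x\<close>.\<close>
      have "b \<bullet> v = w \<bullet> b" if "b \<in> B" for b
        using that B(1) v by (auto simp: inner_right_distrib perpD inner_commute)
      then show ?thesis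
        by (simp add: linear_sum[OF matrix_vector_mul_linear] matrix_vector_mult_scaleR)
    qed
    also have "\<dots> = X *v w"
      using orthonormal_basis_expand[OF B(2,3) _ fin] B(5) v(1) by simp
    finally have 1: "(\<Sum>b\<in>B. (b \<bullet> v) *\<^sub>R (X *v b)) = X *v w" .
    have "(\<Sum>b\<in>B. ((X *v b) \<bullet> v) *\<^sub>R b) = - (\<Sum>b\<in>B. ((X *v x) \<bullet> b) *\<^sub>R b)"
    proof -
      \<comment> \<open>The \<open>w\<close>-part drops out because \<open>X *v b\<close> is normal
        to \<open>W\<close>; skewness then moves \<open>X\<close> from \<open>b\<close> to
        \<open>x\<close>.\<close>
      have "(X *v b) \<bullet> v = - ((X *v x) \<bullet> b)" if "b \<in> B" for b
      proof -
        have "(X *v b) \<bullet> w = 0"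
          using perpD[OF v(1) XW[of b]] that B(1) by (auto simp: inner_commute)
        then show ?thesis
          using v(3) skew_inner[OF skew, of b x] by (simp add: inner_right_distrib inner_commute)
      qed
      then show ?thesis by (simp add: sum_negf)
    qed
    also have "\<dots> = - (X *v x)"
      using orthonormal_basis_expand[OF B(2,3) _ fin] B(5) Xperp[OF v(2)] by simp
    finally show ?thesis
      unfolding Y 1 by (simp add: v(3) matrix_vector_right_distrib)
  qed
  then have "X = ?Y" using matrix_eq by blast
  also have "?Y \<in> mixed_part W"
    unfolding mixed_part_def
  proof (rule span_sum)
    fix b assume "b \<in> B"
    then have "b \<in> W" using B(1) by blast
    then have "wedge b (X *v b) \<in> {wedge w x |w x. w \<in> W \<and> x \<in> W\<^sup>\<bottom>}"
      using XW by auto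
    then show "wedge (X *v b) b \<in> span {wedge w x |w x. w \<in> W \<and> x \<in> W\<^sup>\<bottom>}"
      unfolding wedge_anticommute[of "X *v b" b] by (rule span_neg[OF span_base])
  qed
  finally show ?thesis .
qed

lemma mixed_part_eq: "mixed_part W = {X. transpose X = - X \<and> Ad \<phi> X = - X}"
  using mixed_part_subset mixed_part_supset by blast

text \<open>The group consists of the \<open>P\<close> in the common stabilizer commuting with
  \<open>\<phi>\<close>. Differentiating that equation gives one inclusion, exponentiating gives the
  other.\<close>

lemma lie_algebra_plane_stabilizer:
  assumes forms: "\<And>j. j \<le> N \<Longrightarrow> skew_form (d j) (\<alpha> j)"
  shows "lie_algebra (plane_stabilizer (common_stabilizer N \<alpha>) W) =
         {X \<in> stabilizer_algebra N d \<alpha>. Ad \<phi> X = X}" (is "lie_algebra ?H = _")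
proof (intro equalityI subsetI)
  have orth: "orthogonal_matrix P" if "P \<in> common_stabilizer N \<alpha>" for P
    using that by (simp add: common_stabilizer_def rotation_matrix_def)
  then have H: "?H = {P \<in> common_stabilizer N \<alpha>. P ** \<phi> = \<phi> ** P}"
    using orthogonal_preserves_iff_commutes unfolding plane_stabilizer_def by blast
  {
    fix X assume X: "X \<in> lie_algebra ?H"
    then have "X ** \<phi> = \<phi> ** X"
      by (rule lie_algebra_imp_commutes[rotated]) (simp add: H)
    moreover have "X \<in> lie_algebra (common_stabilizer N \<alpha>)"
      using X lie_algebra_mono[of ?H] unfolding plane_stabilizer_def by blast
    then have "X \<in> stabilizer_algebra N d \<alpha>"
      using lie_algebra_common_stabilizer_subset[where d = d, OF forms] by blast
    ultimately show "X \<in> {X \<in> stabilizer_algebra N d \<alpha>. Ad \<phi> X = X}"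
      by (simp add: Ad_fixed_iff)
  next
    fix X assume "X \<in> {X \<in> stabilizer_algebra N d \<alpha>. Ad \<phi> X = X}"
    then have X: "X \<in> stabilizer_algebra N d \<alpha>" "X ** \<phi> = \<phi> ** X"
      by (auto simp: Ad_fixed_iff)
    show "X \<in> lie_algebra ?H"
    proof (rule lie_algebraI_matrix_exp)
      fix t
      let ?E = "matrix_exp X t"
      have E: "?E \<in> common_stabilizer N \<alpha>"
        using forms X(1) by (rule matrix_exp_in_common_stabilizer)
      \<comment> \<open>For skew \<open>X\<close> this is commutation with \<open>\<phi>\<close>. It
        makes the exponential preserve the bilinear form \<open>\<phi>\<close>, which for an
        orthogonal matrix is again commutation.\<close>
      have "transpose X ** \<phi> + \<phi> ** X = 0"
        using X by (simp add: stabilizer_algebra_def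
            bounded_bilinear.minus_left[OF bounded_bilinear_matrix_mult])
      then have "transpose ?E ** \<phi> ** ?E = \<phi>"
        by (rule matrix_exp_preserves_bilinear_form)
      then have "?E ** \<phi> = \<phi> ** ?E"
        using orth[OF E] by (metis matrix_mul_assoc matrix_mul_lid orthogonal_matrix_def)
      then show "?E \<in> ?H" using E by (simp add: H)
    qed
  }
qed

lemma orthogonal_comp_eq_antiinvariant_iff:
  assumes "subspace \<gg>"
  shows "\<gg> \<inter> {X \<in> \<gg>. Ad \<phi> X = X}\<^sup>\<bottom> = {X \<in> \<gg>. Ad \<phi> X = - X} \<longleftrightarrow> Ad \<phi> ` \<gg> = \<gg>"
    (is "\<gg> \<inter> ?h\<^sup>\<bottom> = ?m \<longleftrightarrow> _")
proof
  assume eq: "\<gg> \<inter> ?h\<^sup>\<bottom> = ?m"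
  have "subspace ?h"
    using assms by (auto simp: subspace_def linear_0[OF linear_Ad] linear_add[OF linear_Ad]
        linear_scale[OF linear_Ad])
  have "Ad \<phi> X \<in> \<gg>" if X: "X \<in> \<gg>" for X
  proof -
    \<comment> \<open>The splitting takes place in the space of all matrices;
      \<open>Z = X - Y\<close> still lies in \<open>\<gg>\<close> because \<open>?h\<close>
      does.\<close>
    have "X \<in> ?h + ?h\<^sup>\<bottom>"
      using subspace_sum_orthogonal_comp[OF \<open>subspace ?h\<close>] by simp
    then obtain Y Z where YZ: "Y \<in> ?h" "Z \<in> ?h\<^sup>\<bottom>" "X = Y + Z"
      by (rule set_plus_elim)
    then have "Z \<in> \<gg>"
      using X assms subspace_diff[of \<gg> X Y] by simp
    then have "Ad \<phi> Z = - Z" using YZ(2) eq by blast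
    then have "Ad \<phi> X = Y - Z"
      using YZ by (simp add: linear_add[OF linear_Ad])
    then show ?thesis
      using YZ(1) \<open>Z \<in> \<gg>\<close> assms by (simp add: subspace_diff)
  qed
  then have sub: "Ad \<phi> ` \<gg> \<subseteq> \<gg>" by blast
  \<comment> \<open>Applying the involution to the inclusion reverses it.\<close>
  then have "Ad \<phi> ` Ad \<phi> ` \<gg> \<subseteq> Ad \<phi> ` \<gg>" by blast
  then show "Ad \<phi> ` \<gg> = \<gg>"
    using sub by (simp add: image_image Ad_involution)
next
  assume inv: "Ad \<phi> ` \<gg> = \<gg>"
  show "\<gg> \<inter> ?h\<^sup>\<bottom> = ?m"
  proof (intro equalityI subsetI)
    fix X assume X: "X \<in> \<gg> \<inter> ?h\<^sup>\<bottom>"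
    \<comment> \<open>The symmetrization of \<open>X\<close> lies in \<open>?h\<close>, so it is
      orthogonal to \<open>X\<close>, and by self-adjointness to \<open>Ad \<phi> X\<close>. Thus
      \<open>S\<close> is orthogonal to itself.\<close>
    define S where "S = X + Ad \<phi> X"
    have AdS: "Ad \<phi> S = S"
      by (simp add: S_def linear_add[OF linear_Ad] Ad_involution)
    have "Ad \<phi> X \<in> \<gg>" using X inv by blast
    then have "S \<in> \<gg>"
      using X assms by (simp add: S_def subspace_add)
    then have "S \<bullet> X = 0"
      using X AdS by (auto simp: orthogonal_comp_def orthogonal_def)
    moreover have "S \<bullet> Ad \<phi> X = S \<bullet> X"
      using Ad_inner[of S X] AdS by simp
    ultimately have "S \<bullet> S = 0"
      by (subst (2) S_def) (simp add: inner_right_distrib)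
    then have "Ad \<phi> X = - X"
      by (simp add: S_def add_eq_0_iff)
    then show "X \<in> ?m" using X by simp
  next
    fix X assume X: "X \<in> ?m"
    \<comment> \<open>Eigenvectors of a self-adjoint map for the eigenvalues 1 and -1 are
      orthogonal.\<close>
    have "Y \<bullet> X = 0" if "Ad \<phi> Y = Y" for Y
      using Ad_inner[of Y X] that X by simp
    then show "X \<in> \<gg> \<inter> ?h\<^sup>\<bottom>"
      using X by (simp add: orthogonal_comp_def orthogonal_def)
  qed
qed

end

theorem theorem2p14:
  fixes \<alpha> :: "nat \<Rightarrow> (real^'n) list \<Rightarrow> real"
    and d :: "nat \<Rightarrow> nat" and N k :: nat
    and W :: "(real^'n) set" and Or :: "(real^'n) list set"
    and \<phi> :: "real^'n^'n"
  defines "G \<equiv> common_stabilizer N \<alpha>"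
  assumes forms: "\<And>j. j \<le> N \<Longrightarrow> skew_form (d j) (\<alpha> j)"
    and deg: "d 0 = k"
    and calib: "calibration k (\<alpha> 0)"
    and trans: "transitive_on_planes G (calibrated_planes k (\<alpha> 0))"
    and W: "(W, Or) \<in> calibrated_planes k (\<alpha> 0)"
    and \<phi>_W: "\<And>w. w \<in> W \<Longrightarrow> \<phi> *v w = w"
    and \<phi>_perp: "\<And>x. x \<in> W\<^sup>\<bottom> \<Longrightarrow> \<phi> *v x = - x"
  shows "(compliant G W \<longleftrightarrow> Ad \<phi> ` lie_algebra G = lie_algebra G) \<and>
         (compliant G W \<longleftrightarrow> restricts_to_lie_automorphism (Ad \<phi>) (lie_algebra G))"
proof -
  have "subspace W"
    using W by (simp add: calibrated_planes_def calibrated_def oriented_planes_def)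
  then interpret plane_reflection W \<phi>
    using \<phi>_W \<phi>_perp by unfold_locales
  let ?g = "stabilizer_algebra N d \<alpha>"
  have g: "lie_algebra G = ?g"
    unfolding G_def using forms by (rule lie_algebra_common_stabilizer)
  \<comment> \<open>The skewness demanded by \<open>mixed_part_eq\<close> is already part of
    membership in \<open>?g\<close>.\<close>
  have "?g \<inter> mixed_part W = {X \<in> ?g. Ad \<phi> X = - X}"
    by (auto simp: mixed_part_eq stabilizer_algebra_def)
  then have "compliant G W \<longleftrightarrow> Ad \<phi> ` lie_algebra G = lie_algebra G"
    using orthogonal_comp_eq_antiinvariant_iff[OF subspace_stabilizer_algebra[OF forms]]
      lie_algebra_plane_stabilizer[OF forms]
    \<comment> \<open>\<open>G\<close> stays folded while \<open>g\<close> rewrites its Lie algebra;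
      unfolding it afterwards exposes the plane stabilizer to its own description.\<close>
    by (simp add: compliant_def g) (simp add: G_def)
  then show ?thesis
    by (simp add: restricts_to_lie_automorphism_iff)
qed

end
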